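(* Let $m,n$ be positive integers with $m<n$, let $a_k>0$ for $k=1,\ldots,n-m$, let $A=\operatorname{diag}(a_1,\ldots,a_{n-m},0,\ldots,0)\in\mathbb{R}^{n\times n}$, and let $B$ be a real symmetric $n\times n$ matrix. Then the characteristic polynomial $p_{A+tB}(x)=\det(xI-A-tB)$ of $A+tB$ is given by $$p_{A+tB}(x)=\sum_{i=0}^{n}\ \sum_{j=m-i}^{n-i}(-1)^{n-i}\,\bigl\langle \operatorname{adj}_{i+j}(A),\,C_{i+j}^{j}(B)\bigr\rangle\, t^{j}x^{i}.$$
   Context: Notation. $[n]=\{1,\ldots,n\}$; $\langle n\rangle_k$ is the set of all $k$-element subsets of $[n]$, ordered lexicographically. For $\alpha\subset[n]$, $|\alpha|$ denotes the sum of the elements of $\alpha$ and $\alpha^c=[n]\setminus\alpha$. For an $n\times n$ matrix $X$, $X[\alpha,\beta]$ is the submatrix with rows indexed by $\alpha$ and columns indexed by $\beta$. $\langle U,V\rangle=\operatorname{tr}(UV)$. For a square matrix $X$, $\sum_{d\times d}|X|$ denotes the sum of all $d\times d$ principal minors of $X$, with $\sum_{0\times0}|X|=1$. $k$-th adjugate: $\operatorname{adj}_k(A)$ is the $\binom nk\times\binom nk$ matrix indexed by $\langle n\rangle_k$ with entries $\operatorname{adj}_k(A)_{\alpha,\beta}=(-1)^{|\alpha|+|\beta|}\det A[\beta^c,\alpha^c]$ for $0<k<n$; also $\operatorname{adj}_0(A)=\det A$, $\operatorname{adj}_n(A)=1$. $C_k^d(B)$: for $1\le d\le k\le n$, $C_k^d(B)$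 is the $\binom nk\times\binom nk$ matrix indexed by $\langle n\rangle_k$ with entries $C_k^d(B)_{\alpha,\beta}=\sum_{d\times d}|B[\alpha,\beta]|$ (where $B[\alpha,\beta]$ is regarded as a $k\times k$ matrix by enumerating $\alpha$ and $\beta$ increasingly). For $d=0$, $C_k^0(B)$ is by definition the identity matrix of size $\binom nk$, and for $d<0$, $C_k^d(B)$ is the zero matrix (so terms with $j<0$ in the sum vanish). *)

theory Defs
  imports
    "Jordan_Normal_Form.Char_Poly"
    "Jordan_Normal_Form.DL_Submatrix"
    "HOL-Library.List_Lexorder"
begin

text \<open>Matrices of \<^theory>\<open>Jordan_Normal_Form.Matrix\<close> are indexed from \<open>0\<close>, so the index set
  \<open>[n] = {1,...,n}\<close> is represented by \<open>{0..<n}\<close>. The shift preserves the lexicographic order of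
  the \<open>k\<close>-element subsets, and it changes the sum \<open>|\<alpha>| + |\<beta>|\<close> for \<open>k\<close>-element \<open>\<alpha>\<close>, \<open>\<beta>\<close> by the even
  number \<open>2 * k\<close>, so the signs in the \<open>k\<close>-th adjugate are unaffected.\<close>

text \<open>A subset is identified with its increasing list of elements (the inner
  \<^const>\<open>sorted_list_of_set\<close>); the outer \<^const>\<open>sorted_list_of_set\<close> sorts these lists in the
  lexicographic order of \<^theory>\<open>HOL-Library.List_Lexorder\<close>.\<close>

definition k_subsets :: "nat \<Rightarrow> nat \<Rightarrow> nat set list" where
  "k_subsets n k =
     map set (sorted_list_of_set (sorted_list_of_set ` {\<alpha>. \<alpha> \<subseteq> {0..<n} \<and> card \<alpha> = k}))"

definition mat_trace :: "'a :: comm_monoid_add mat \<Rightarrow> 'a" where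
  "mat_trace X = (\<Sum>i<dim_row X. X $$ (i, i))"

definition mat_pairing :: "'a :: semiring_0 mat \<Rightarrow> 'a mat \<Rightarrow> 'a" where
  "mat_pairing U V = mat_trace (U * V)"

text \<open>The case \<open>d = 0\<close> agrees with the convention that the sum is then \<open>1\<close>, the determinant of the
  empty matrix: see \<open>sum_principal_minors_0\<close> below.\<close>

definition sum_principal_minors :: "nat \<Rightarrow> 'a :: comm_ring_1 mat \<Rightarrow> 'a" where
  "sum_principal_minors d X =
     (\<Sum>\<gamma> | \<gamma> \<subseteq> {0..<dim_row X} \<and> card \<gamma> = d. det (submatrix X \<gamma> \<gamma>))"

text \<open>The scalars \<open>adj\<^sub>0(A) = det A\<close> and \<open>adj\<^sub>n(A) = 1\<close> are \<open>1 \<times> 1\<close> matrices.\<close>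

definition adj_k :: "nat \<Rightarrow> 'a :: comm_ring_1 mat \<Rightarrow> 'a mat" where
  "adj_k k A = (let n = dim_row A in
     if k = 0 then mat 1 1 (\<lambda>_. det A)
     else if k = n then 1\<^sub>m 1
     else mat (n choose k) (n choose k) (\<lambda>(r, s).
       let \<alpha> = k_subsets n k ! r; \<beta> = k_subsets n k ! s
       in (- 1) ^ (\<Sum>\<alpha> + \<Sum>\<beta>) * det (submatrix A ({0..<n} - \<beta>) ({0..<n} - \<alpha>))))"

text \<open>Only \<open>d \<le> k \<le> dim_row B\<close> is meaningful. The case \<open>d = 0\<close> is not an instance of the
  general formula, which would give the all-ones matrix.\<close>

definition C_kd :: "nat \<Rightarrow> int \<Rightarrow> 'a :: comm_ring_1 mat \<Rightarrow> 'a mat" where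
  "C_kd k d B = (let n = dim_row B in
     if d < 0 then 0\<^sub>m (n choose k) (n choose k)
     else if d = 0 then 1\<^sub>m (n choose k)
     else mat (n choose k) (n choose k) (\<lambda>(r, s).
       sum_principal_minors (nat d) (submatrix B (k_subsets n k ! r) (k_subsets n k ! s))))"

lemma sum_principal_minors_0: "sum_principal_minors 0 X = 1"
proof -
  have "\<gamma> = {}" if "\<gamma> \<subseteq> {0..<dim_row X}" "card \<gamma> = 0" for \<gamma>
    using finite_subset[OF that(1)] that(2) by simp
  then have "{\<gamma>. \<gamma> \<subseteq> {0..<dim_row X} \<and> card \<gamma> = 0} = {{}}"
    by (intro equalityI subsetI) simp_all
  moreover have "det (submatrix X {} {}) = 1"
    by (simp add: submatrix_def)
  ultimately show ?thesis by (simp add: sum_principal_minors_def)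
qed

lemma finite_k_subsets: "finite {\<alpha>. \<alpha> \<subseteq> {0..<n::nat} \<and> card \<alpha> = k}"
  by (rule finite_subset[OF _ finite_Pow_iff[THEN iffD2, OF finite_atLeastLessThan[of 0 n]]]) blast

lemma set_sorted_list_of_k_subset:
  assumes "\<alpha> \<in> {\<alpha>. \<alpha> \<subseteq> {0..<n::nat} \<and> card \<alpha> = k}"
  shows "set (sorted_list_of_set \<alpha>) = \<alpha>"
proof -
  have "\<alpha> \<subseteq> {0..<n}" using assms by simp
  then have "finite \<alpha>" by (rule finite_subset) simp
  then show ?thesis by simp
qed

lemma set_k_subsets: "set (k_subsets n k) = {\<alpha>. \<alpha> \<subseteq> {0..<n} \<and> card \<alpha> = k}" (is "_ = ?S")
proof -
  have "set (k_subsets n k) = (\<lambda>\<alpha>. set (sorted_list_of_set \<alpha>)) ` ?S"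
    unfolding k_subsets_def set_map
    by (subst set_sorted_list_of_set) (rule finite_imageI finite_k_subsets image_image)+
  also have "\<dots> = (\<lambda>\<alpha>. \<alpha>) ` ?S"
    by (rule image_cong[OF refl set_sorted_list_of_k_subset])
  finally show ?thesis by simp
qed

lemma length_k_subsets: "length (k_subsets n k) = n choose k"
proof -
  have "inj_on sorted_list_of_set {\<alpha>. \<alpha> \<subseteq> {0..<n} \<and> card \<alpha> = k}"
    by (rule inj_on_inverseI[of _ set]) (rule set_sorted_list_of_k_subset)
  then show ?thesis
    using n_subsets[of "{0..<n}" k] by (simp add: k_subsets_def card_image)
qed

lemma distinct_k_subsets: "distinct (k_subsets n k)"
  using n_subsets[of "{0..<n}" k]
  by (intro card_distinct) (simp add: set_k_subsets length_k_subsets)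

end

theory Submission
  imports Defs
begin

text \<open>
  Write \<open>N\<close> for the index set and \<open>B[\<gamma>]\<close> for the principal minor of \<open>B\<close> on \<open>\<gamma> \<subseteq> N\<close>. Adding a
  diagonal matrix to a matrix \<open>M\<close> changes the determinant in a controlled way: choosing in the
  Leibniz formula, for each row, either the entry of \<open>M\<close> or the diagonal entry gives
  \<open>det (diag d + M) = \<Sum>\<^sub>\<gamma> M[\<gamma>] * \<Prod>\<^sub>r\<^sub>\<notin>\<^sub>\<gamma> d\<^sub>r\<close> (\<open>det_mat_diag_add\<close>), since a permutation that survives the
  diagonal choice fixes every point outside \<open>\<gamma>\<close>. For \<open>xI - A - tB\<close>, with \<open>d\<^sub>r = x - a\<^sub>r\<close> and
  \<open>M = -tB\<close>, a further expansion of the products of \<open>x - a\<^sub>r\<close> writes the characteristic polynomial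
  as a sum over pairs of disjoint sets \<open>\<gamma>\<close> and \<open>\<delta>\<close>, the rows that contribute an entry of \<open>-tB\<close> and
  the rows that contribute \<open>x\<close>; the remaining rows contribute \<open>-a\<^sub>r\<close>
  (\<open>char_poly_diag_add_smult\<close>).

  On the other side, all adjugates of a diagonal matrix are diagonal (\<open>adj_k_mat_diag\<close>): the entry
  at \<open>\<alpha>\<close> is the product of the \<open>a\<^sub>r\<close> over the complement of \<open>\<alpha>\<close>. Hence only the diagonal entries of
  \<open>C\<^sub>k\<^sup>j(B)\<close> enter the pairing, and the entry at \<open>\<alpha>\<close> is the sum of \<open>B[\<gamma>]\<close> over the \<open>j\<close>-element subsets
  \<open>\<gamma>\<close> of \<open>\<alpha>\<close> (\<open>mat_pairing_adj_k_C_kd\<close>).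

  Putting \<open>\<alpha> = \<gamma> \<union> \<delta>\<close>, \<open>i = card \<delta>\<close> and \<open>j = card \<gamma>\<close> matches the two sides term by term
  (\<open>sum_disjoint_pairs_by_card\<close>). The range of \<open>j\<close> starts at \<open>m - i\<close> because a set \<open>\<alpha>\<close> with fewer than
  \<open>m\<close> elements misses one of the last \<open>m\<close> indices, where the diagonal of \<open>A\<close> vanishes.
\<close>

section \<open>Principal minors as sums over permutations\<close>

text \<open>The Leibniz formula on the index set itself: unlike the determinant of a submatrix it needs no
  renumbering of \<open>I\<close>, so minors of submatrices and terms of a larger Leibniz sum can be compared
  directly.\<close>

definition principal_minor :: "'a :: comm_ring_1 mat \<Rightarrow> nat set \<Rightarrow> 'a" where
  "principal_minor M I = (\<Sum>p | p permutes I. signof p * (\<Prod>i\<in>I. M $$ (i, p i)))"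

lemma principal_minor_empty [simp]: "principal_minor M {} = 1"
  by (simp add: principal_minor_def)

text \<open>Conjugating by \<open>f\<close> carries the permutations of \<open>{0..<k}\<close> to those of \<open>I\<close> and keeps the sign.
  The bijection is arbitrary, so the lemma also covers a submatrix of a submatrix, where \<open>f\<close> is a
  composition of two enumerations.\<close>

lemma det_reindexed:
  assumes f: "bij_betw f {0..<k} I"
  shows "det (mat k k (\<lambda>(i, j). M $$ (f i, f j))) = principal_minor M I"
proof -
  let ?K = "{0..<k}"
  have inj: "inj_on f ?K" and fin: "finite I"
    using f by (auto simp: bij_betw_def)
  have bij: "bij_betw (map_permutation ?K f) {p. p permutes ?K} {p. p permutes I}"
  proof (rule bij_betw_byWitness[where f' = "map_permutation I (inv_into ?K f)"])
    show "map_permutation ?K f ` {p. p permutes ?K} \<subseteq> {p. p permutes I}"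
      using map_permutation_permutes[OF f] by auto
    show "map_permutation I (inv_into ?K f) ` {p. p permutes I} \<subseteq> {p. p permutes ?K}"
      using map_permutation_permutes[OF bij_betw_inv_into[OF f]] by auto
    show "\<forall>p\<in>{p. p permutes ?K}. map_permutation I (inv_into ?K f) (map_permutation ?K f p) = p"
      using f inj by (auto intro!: map_permutation_compose_inv simp: inv_into_f_f)
    show "\<forall>p\<in>{p. p permutes I}. map_permutation ?K f (map_permutation I (inv_into ?K f) p) = p"
      using f by (auto intro!: map_permutation_compose_inv bij_betw_inv_into
          simp: bij_betw_inv_into_right)
  qed
  have "principal_minor M I =
      (\<Sum>p | p permutes ?K. signof (map_permutation ?K f p) *
        (\<Prod>i\<in>I. M $$ (i, map_permutation ?K f p i)))"
    unfolding principal_minor_def by (rule sum.reindex_bij_betw[OF bij, symmetric])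
  also have "\<dots> = (\<Sum>p | p permutes ?K. signof p * (\<Prod>i\<in>?K. M $$ (f i, f (p i))))"
  proof (rule sum.cong[OF refl])
    fix p assume "p \<in> {p. p permutes ?K}"
    then have p: "p permutes ?K" by simp
    have "(\<Prod>i\<in>I. M $$ (i, map_permutation ?K f p i)) =
        (\<Prod>i\<in>?K. M $$ (f i, map_permutation ?K f p (f i)))"
      by (rule prod.reindex_bij_betw[OF f, symmetric])
    also have "\<dots> = (\<Prod>i\<in>?K. M $$ (f i, f (p i)))"
      by (rule prod.cong) (simp_all add: map_permutation_apply[OF inj])
    finally show "signof (map_permutation ?K f p) * (\<Prod>i\<in>I. M $$ (i, map_permutation ?K f p i)) =
        signof p * (\<Prod>i\<in>?K. M $$ (f i, f (p i)))"
      using sign_map_permutation[OF inj p] by simp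
  qed
  also have "\<dots> = det (mat k k (\<lambda>(i, j). M $$ (f i, f j)))"
    unfolding det_def
    by (auto intro!: sum.cong prod.cong dest: permutes_in_image[of _ ?K])
  finally show ?thesis by simp
qed

lemma bij_betw_pick:
  assumes "finite I"
  shows "bij_betw (pick I) {0..<card I} I"
proof -
  have inj: "inj_on (pick I) {0..<card I}"
    by (rule inj_on_inverseI[of _ "\<lambda>x. card {a \<in> I. a < x}"]) (simp add: card_pick)
  moreover have "pick I ` {0..<card I} = I"
    using inj assms by (intro card_subset_eq) (auto simp: pick_in_set card_image)
  ultimately show ?thesis by (simp add: bij_betw_def)
qed

lemma submatrix_eq_mat:
  assumes "M \<in> carrier_mat n n" "I \<subseteq> {0..<n}" "J \<subseteq> {0..<n}"
  shows "submatrix M I J = mat (card I) (card J) (\<lambda>(i, j). M $$ (pick I i, pick J j))"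
proof -
  have "{i. i < n \<and> i \<in> I} = I" "{j. j < n \<and> j \<in> J} = J"
    using assms by auto
  then show ?thesis
    using assms by (simp add: submatrix_def)
qed

lemma det_submatrix_diagonal_block:
  assumes "M \<in> carrier_mat n n" "I \<subseteq> {0..<n}"
  shows "det (submatrix M I I) = principal_minor M I"
  using assms bij_betw_pick[of I] finite_subset[of I "{0..<n}"]
  by (simp add: submatrix_eq_mat det_reindexed)

text \<open>The principal minors of the block on \<open>\<alpha>\<close> are the principal minors of \<open>M\<close> on the subsets of
  \<open>\<alpha>\<close>: the enumeration of \<open>\<alpha>\<close> identifies subsets of positions with subsets of \<open>\<alpha>\<close>.\<close>

lemma sum_principal_minors_submatrix:
  assumes M: "M \<in> carrier_mat n n" and \<alpha>: "\<alpha> \<subseteq> {0..<n}"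
  shows "sum_principal_minors d (submatrix M \<alpha> \<alpha>) =
    (\<Sum>\<gamma> | \<gamma> \<subseteq> \<alpha> \<and> card \<gamma> = d. principal_minor M \<gamma>)"
proof -
  let ?K = "{0..<card \<alpha>}"
  let ?X = "submatrix M \<alpha> \<alpha>"
  have pick: "bij_betw (pick \<alpha>) ?K \<alpha>"
    using \<alpha> finite_subset bij_betw_pick by blast
  have X: "?X = mat (card \<alpha>) (card \<alpha>) (\<lambda>(i, j). M $$ (pick \<alpha> i, pick \<alpha> j))"
    by (rule submatrix_eq_mat[OF M \<alpha> \<alpha>])
  have block: "det (submatrix ?X \<gamma> \<gamma>) = principal_minor M (pick \<alpha> ` \<gamma>)" if "\<gamma> \<subseteq> ?K" for \<gamma>
  proof -
    have \<gamma>: "bij_betw (pick \<gamma>) {0..<card \<gamma>} \<gamma>"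
      using that finite_subset bij_betw_pick by blast
    have "pick \<gamma> i \<in> ?K" if "i < card \<gamma>" for i
      using bij_betwE[OF \<gamma>] that \<open>\<gamma> \<subseteq> ?K\<close> by (auto simp: subset_iff)
    then have "submatrix ?X \<gamma> \<gamma> = mat (card \<gamma>) (card \<gamma>)
        (\<lambda>(i, j). M $$ ((pick \<alpha> \<circ> pick \<gamma>) i, (pick \<alpha> \<circ> pick \<gamma>) j))"
      using that by (subst submatrix_eq_mat[of _ "card \<alpha>"]) (auto simp: X intro!: cong_mat)
    moreover have "bij_betw (pick \<alpha> \<circ> pick \<gamma>) {0..<card \<gamma>} (pick \<alpha> ` \<gamma>)"
      using \<gamma> bij_betw_subset[OF pick that] by (auto intro: bij_betw_trans)
    ultimately show ?thesis
      by (simp only: det_reindexed)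
  qed
  have inj: "inj_on (pick \<alpha>) ?K" and img: "pick \<alpha> ` ?K = \<alpha>"
    using pick by (auto simp: bij_betw_def)
  have "bij_betw ((`) (pick \<alpha>)) (Pow ?K) (Pow \<alpha>)"
    by (rule bij_betw_Pow[OF pick])
  then have "bij_betw ((`) (pick \<alpha>)) {\<gamma>. \<gamma> \<subseteq> ?K \<and> card \<gamma> = d} {\<gamma>. \<gamma> \<subseteq> \<alpha> \<and> card \<gamma> = d}"
  proof (rule bij_betw_subset)
    show "{\<gamma>. \<gamma> \<subseteq> ?K \<and> card \<gamma> = d} \<subseteq> Pow ?K" by auto
    have "card (pick \<alpha> ` \<gamma>) = card \<gamma>" if "\<gamma> \<subseteq> ?K" for \<gamma>
      using inj that by (metis card_image inj_on_subset)
    then show "(`) (pick \<alpha>) ` {\<gamma>. \<gamma> \<subseteq> ?K \<and> card \<gamma> = d} = {\<gamma>. \<gamma> \<subseteq> \<alpha> \<and> card \<gamma> = d}"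
      using subset_image_iff[of _ "pick \<alpha>" ?K] img by (auto simp: image_iff)
  qed
  then have "(\<Sum>\<gamma> | \<gamma> \<subseteq> ?K \<and> card \<gamma> = d. principal_minor M (pick \<alpha> ` \<gamma>)) =
      (\<Sum>\<gamma> | \<gamma> \<subseteq> \<alpha> \<and> card \<gamma> = d. principal_minor M \<gamma>)"
    by (rule sum.reindex_bij_betw)
  then show ?thesis
    by (simp add: sum_principal_minors_def X[THEN arg_cong, of dim_row] block)
qed

section \<open>The characteristic polynomial of a diagonal matrix plus a matrix\<close>

text \<open>Expand each product in the Leibniz formula of the sum by the set \<open>\<gamma>\<close> of rows in which the entry
  of \<open>M\<close> is taken. In the other rows the diagonal entry is nonzero only at fixed points, so exactly
  the permutations of \<open>\<gamma>\<close> remain, and they make up a principal minor.\<close>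

lemma det_mat_diag_add:
  fixes M :: "'a :: comm_ring_1 mat"
  assumes M: "M \<in> carrier_mat n n"
  shows "det (mat_diag n d + M) =
    (\<Sum>\<gamma>\<in>Pow {0..<n}. principal_minor M \<gamma> * (\<Prod>r\<in>{0..<n} - \<gamma>. d r))"
proof -
  let ?N = "{0..<n}"
  have restrict: "(\<Sum>p | p permutes ?N. signof p * (\<Prod>i\<in>\<gamma>. M $$ (i, p i)) *
        (\<Prod>i\<in>?N - \<gamma>. if i = p i then d (p i) else 0)) =
      principal_minor M \<gamma> * (\<Prod>r\<in>?N - \<gamma>. d r)" (is "?l = ?r") if "\<gamma> \<subseteq> ?N" for \<gamma>
  proof -
    have "?l = (\<Sum>p | p permutes \<gamma>. signof p * (\<Prod>i\<in>\<gamma>. M $$ (i, p i)) *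
        (\<Prod>i\<in>?N - \<gamma>. if i = p i then d (p i) else 0))"
    proof (rule sum.mono_neutral_right)
      show "finite {p. p permutes ?N}" by (simp add: finite_permutations)
      show "{p. p permutes \<gamma>} \<subseteq> {p. p permutes ?N}"
        using that by (auto intro: permutes_subset)
      show "\<forall>p\<in>{p. p permutes ?N} - {p. p permutes \<gamma>}. signof p * (\<Prod>i\<in>\<gamma>. M $$ (i, p i)) *
          (\<Prod>i\<in>?N - \<gamma>. if i = p i then d (p i) else 0) = 0"
      proof
        fix p assume p: "p \<in> {p. p permutes ?N} - {p. p permutes \<gamma>}"
        then obtain i where "i \<in> ?N - \<gamma>" "p i \<noteq> i"
          using permutes_superset[of p ?N \<gamma>] by blast
        then have "(\<Prod>i\<in>?N - \<gamma>. if i = p i then d (p i) else 0) = 0"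
          by (intro prod_zero bexI[of _ i]) simp_all
        then show "signof p * (\<Prod>i\<in>\<gamma>. M $$ (i, p i)) *
            (\<Prod>i\<in>?N - \<gamma>. if i = p i then d (p i) else 0) = 0"
          by simp
      qed
    qed
    also have "\<dots> = (\<Sum>p | p permutes \<gamma>. signof p * (\<Prod>i\<in>\<gamma>. M $$ (i, p i)) *
        (\<Prod>r\<in>?N - \<gamma>. d r))"
      by (intro sum.cong refl arg_cong2[of _ _ _ _ "(*)"] prod.cong) (auto simp: permutes_not_in)
    also have "\<dots> = ?r"
      by (simp add: principal_minor_def sum_distrib_right)
    finally show ?thesis .
  qed
  have "det (mat_diag n d + M) = (\<Sum>p | p permutes ?N. signof p *
      (\<Prod>i\<in>?N. M $$ (i, p i) + (if i = p i then d (p i) else 0)))"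
    using M
    by (subst det_def'[of _ n])
      (auto intro!: sum.cong prod.cong simp: mat_diag_def add.commute
        dest: permutes_in_image[of _ ?N])
  also have "\<dots> = (\<Sum>p | p permutes ?N. \<Sum>\<gamma>\<in>Pow ?N. signof p * (\<Prod>i\<in>\<gamma>. M $$ (i, p i)) *
      (\<Prod>i\<in>?N - \<gamma>. if i = p i then d (p i) else 0))"
    by (simp add: prod_add sum_distrib_left mult.assoc)
  also have "\<dots> = (\<Sum>\<gamma>\<in>Pow ?N. \<Sum>p | p permutes ?N. signof p * (\<Prod>i\<in>\<gamma>. M $$ (i, p i)) *
      (\<Prod>i\<in>?N - \<gamma>. if i = p i then d (p i) else 0))"
    by (rule sum.swap)
  also have "\<dots> = (\<Sum>\<gamma>\<in>Pow ?N. principal_minor M \<gamma> * (\<Prod>r\<in>?N - \<gamma>. d r))"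
    by (rule sum.cong[OF refl]) (use restrict in auto)
  finally show ?thesis .
qed

text \<open>Constant polynomials form a subring, so coefficients can be pulled out of a determinant over the
  polynomial ring.\<close>

lemma const_poly_sum: "[:\<Sum>x\<in>S. f x:] = (\<Sum>x\<in>S. [:f x:])"
proof (induction S rule: infinite_finite_induct)
  case (insert x S)
  have "[:f x + sum f S:] = [:f x:] + [:sum f S:]" by simp
  with insert show ?case by (simp del: add_pCons)
qed simp_all

lemma const_poly_prod: "[:\<Prod>x\<in>S. f x:] = (\<Prod>x\<in>S. [:f x:])"
proof (induction S rule: infinite_finite_induct)
  case (insert x S)
  have "[:f x * prod f S:] = [:f x:] * [:prod f S:]" by (simp add: mult.commute)
  with insert show ?case by (simp del: mult_pCons_left mult_pCons_right)
qed (simp_all add: one_pCons)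

lemma principal_minor_lift_smult:
  fixes B :: "'a :: comm_ring_1 mat"
  assumes "B \<in> carrier_mat n n" "\<gamma> \<subseteq> {0..<n}"
  shows "principal_minor (map_mat (\<lambda>b. [:c * b:]) B) \<gamma> = [:c ^ card \<gamma> * principal_minor B \<gamma>:]"
proof -
  have "signof p * (\<Prod>i\<in>\<gamma>. map_mat (\<lambda>b. [:c * b:]) B $$ (i, p i)) =
      [:c ^ card \<gamma> * (signof p * (\<Prod>i\<in>\<gamma>. B $$ (i, p i))):]" if "p permutes \<gamma>" for p
  proof -
    have "(\<Prod>i\<in>\<gamma>. map_mat (\<lambda>b. [:c * b:]) B $$ (i, p i)) = (\<Prod>i\<in>\<gamma>. [:c * B $$ (i, p i):])"
    proof (rule prod.cong[OF refl])
      fix i assume "i \<in> \<gamma>"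
      then have "i < n" "p i < n"
        using assms(2) permutes_in_image[OF that, of i] by (auto simp: subset_iff)
      then show "map_mat (\<lambda>b. [:c * b:]) B $$ (i, p i) = [:c * B $$ (i, p i):]"
        using assms(1) by simp
    qed
    also have "\<dots> = [:\<Prod>i\<in>\<gamma>. c * B $$ (i, p i):]"
      by (rule const_poly_prod[symmetric])
    also have "\<dots> = [:c ^ card \<gamma> * (\<Prod>i\<in>\<gamma>. B $$ (i, p i)):]"
      by (simp add: prod.distrib)
    finally show ?thesis
      by (simp add: sign_def)
  qed
  then show ?thesis
    by (simp add: principal_minor_def sum_distrib_left const_poly_sum)
qed


text \<open>Over the polynomial ring \<open>xI - diag a - tB\<close> is a diagonal matrix with entries \<open>x - a\<^sub>r\<close> plus
  \<open>-tB\<close>. In the resulting sum \<open>\<delta>\<close> is the set of rows that contribute \<open>x\<close>, and each of the other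
  \<open>n - card \<delta>\<close> rows contributes a factor \<open>-1\<close>.\<close>

lemma char_poly_diag_add_smult:
  fixes a :: "nat \<Rightarrow> 'a :: comm_ring_1"
  assumes B: "B \<in> carrier_mat n n"
  shows "char_poly (mat_diag n a + t \<cdot>\<^sub>m B) =
    (\<Sum>\<gamma>\<in>Pow {0..<n}. \<Sum>\<delta>\<in>Pow ({0..<n} - \<gamma>).
      monom ((- 1) ^ (n - card \<delta>) *
        (t ^ card \<gamma> * ((\<Prod>r\<in>{0..<n} - \<gamma> - \<delta>. a r) * principal_minor B \<gamma>))) (card \<delta>))"
proof -
  let ?N = "{0..<n}"
  have "char_poly_matrix (mat_diag n a + t \<cdot>\<^sub>m B) =
      mat_diag n (\<lambda>r. [:0, 1:] + [:- a r:]) + map_mat (\<lambda>b. [:- t * b:]) B"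
    using B by (intro eq_matI) (auto simp: char_poly_matrix_def mat_diag_def)
  then have "char_poly (mat_diag n a + t \<cdot>\<^sub>m B) =
      (\<Sum>\<gamma>\<in>Pow ?N. principal_minor (map_mat (\<lambda>b. [:- t * b:]) B) \<gamma> *
        (\<Prod>r\<in>?N - \<gamma>. [:0, 1:] + [:- a r:]))"
    using B by (simp only: char_poly_def) (rule det_mat_diag_add, simp)
  also have "\<dots> = (\<Sum>\<gamma>\<in>Pow ?N. \<Sum>\<delta>\<in>Pow (?N - \<gamma>).
      monom ((- 1) ^ (n - card \<delta>) *
        (t ^ card \<gamma> * ((\<Prod>r\<in>?N - \<gamma> - \<delta>. a r) * principal_minor B \<gamma>))) (card \<delta>))"
  proof (rule sum.cong[OF refl])
    fix \<gamma> assume "\<gamma> \<in> Pow ?N"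
    then have \<gamma>: "\<gamma> \<subseteq> ?N" by simp
    have "principal_minor (map_mat (\<lambda>b. [:- t * b:]) B) \<gamma> * (\<Prod>r\<in>?N - \<gamma>. [:0, 1:] + [:- a r:]) =
        (\<Sum>\<delta>\<in>Pow (?N - \<gamma>). [:(- t) ^ card \<gamma> * principal_minor B \<gamma>:] *
          (monom 1 (card \<delta>) * [:\<Prod>r\<in>?N - \<gamma> - \<delta>. - a r:]))"
      unfolding principal_minor_lift_smult[OF B \<gamma>] const_poly_prod
      by (simp add: prod_add sum_distrib_left monom_altdef del: add_pCons)
    also have "\<dots> = (\<Sum>\<delta>\<in>Pow (?N - \<gamma>). monom ((- 1) ^ (n - card \<delta>) *
        (t ^ card \<gamma> * ((\<Prod>r\<in>?N - \<gamma> - \<delta>. a r) * principal_minor B \<gamma>))) (card \<delta>))"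
    proof (rule sum.cong[OF refl])
      fix \<delta> assume \<delta>: "\<delta> \<in> Pow (?N - \<gamma>)"
      have fin: "finite \<gamma>" "finite \<delta>"
        using \<gamma> \<delta> by (auto intro: finite_subset[of _ ?N])
      have "\<gamma> \<subseteq> ?N - \<delta>" "?N - \<gamma> - \<delta> = (?N - \<delta>) - \<gamma>" "\<delta> \<subseteq> ?N"
        using \<gamma> \<delta> by auto
      then have exp: "n - card \<delta> = card \<gamma> + card (?N - \<gamma> - \<delta>)"
        using fin card_mono[of "?N - \<delta>" \<gamma>] by (simp add: card_Diff_subset)
      have "(\<Prod>r\<in>?N - \<gamma> - \<delta>. - a r) = (- 1) ^ card (?N - \<gamma> - \<delta>) * (\<Prod>r\<in>?N - \<gamma> - \<delta>. a r)"
        by (rule prod_uminus)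
      moreover have "(- t) ^ card \<gamma> = (- 1) ^ card \<gamma> * t ^ card \<gamma>"
        by (rule power_minus)
      ultimately show "[:(- t) ^ card \<gamma> * principal_minor B \<gamma>:] *
          (monom 1 (card \<delta>) * [:\<Prod>r\<in>?N - \<gamma> - \<delta>. - a r:]) =
          monom ((- 1) ^ (n - card \<delta>) *
            (t ^ card \<gamma> * ((\<Prod>r\<in>?N - \<gamma> - \<delta>. a r) * principal_minor B \<gamma>))) (card \<delta>)"
        by (simp add: exp power_add smult_monom mult.commute[of "monom _ _"] mult_ac)
    qed
    finally show "principal_minor (map_mat (\<lambda>b. [:- t * b:]) B) \<gamma> *
        (\<Prod>r\<in>?N - \<gamma>. [:0, 1:] + [:- a r:]) =
        (\<Sum>\<delta>\<in>Pow (?N - \<gamma>). monom ((- 1) ^ (n - card \<delta>) *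
          (t ^ card \<gamma> * ((\<Prod>r\<in>?N - \<gamma> - \<delta>. a r) * principal_minor B \<gamma>))) (card \<delta>))" .
  qed
  finally show ?thesis .
qed

section \<open>Regrouping by cardinality\<close>

text \<open>A pair of disjoint sets \<open>\<gamma>\<close>, \<open>\<delta>\<close> is the same as a set \<open>\<alpha> = \<gamma> \<union> \<delta>\<close> with a subset \<open>\<gamma>\<close>; the pairs
  are collected by \<open>i = card \<delta>\<close> and \<open>j = card \<gamma>\<close>.\<close>

lemma sum_disjoint_pairs_by_card:
  fixes F :: "'b set \<Rightarrow> 'b set \<Rightarrow> 'c :: comm_monoid_add"
  assumes N: "finite N"
  shows "(\<Sum>\<gamma>\<in>Pow N. \<Sum>\<delta>\<in>Pow (N - \<gamma>). F \<gamma> \<delta>) =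
    (\<Sum>i = 0..card N. \<Sum>j = 0..card N - i.
      \<Sum>\<alpha> | \<alpha> \<subseteq> N \<and> card \<alpha> = i + j. \<Sum>\<gamma> | \<gamma> \<subseteq> \<alpha> \<and> card \<gamma> = j. F \<gamma> (\<alpha> - \<gamma>))"
proof -
  define S where "S = (SIGMA \<gamma>:Pow N. Pow (N - \<gamma>))"
  define T where "T = (SIGMA i:{0..card N}. {0..card N - i})"
  let ?g = "\<lambda>(\<gamma>, \<delta>). (card \<delta>, card \<gamma>)"
  have S: "finite \<gamma> \<and> finite \<delta> \<and> \<gamma> \<inter> \<delta> = {} \<and> \<gamma> \<union> \<delta> \<subseteq> N" if "(\<gamma>, \<delta>) \<in> S" for \<gamma> \<delta>
    using that finite_subset[OF _ N] by (auto simp: S_def)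
  have fin: "finite S" "finite T"
    using N by (auto simp: S_def T_def)
  have img: "?g ` S \<subseteq> T"
  proof clarify
    fix \<gamma> \<delta> assume "(\<gamma>, \<delta>) \<in> S"
    from S[OF this] have "card \<gamma> + card \<delta> \<le> card N"
      using card_mono[OF N, of "\<gamma> \<union> \<delta>"] by (simp add: card_Un_disjoint)
    then show "(card \<delta>, card \<gamma>) \<in> T" by (auto simp: T_def)
  qed
  have fibre: "(\<Sum>(\<gamma>, \<delta>) | (\<gamma>, \<delta>) \<in> S \<and> ?g (\<gamma>, \<delta>) = (i, j). F \<gamma> \<delta>) =
      (\<Sum>\<alpha> | \<alpha> \<subseteq> N \<and> card \<alpha> = i + j. \<Sum>\<gamma> | \<gamma> \<subseteq> \<alpha> \<and> card \<gamma> = j. F \<gamma> (\<alpha> - \<gamma>))" for i j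
  proof -
    have fin: "finite {\<alpha>. \<alpha> \<subseteq> N \<and> card \<alpha> = i + j}"
      using N by simp
    have fin': "\<forall>\<alpha>\<in>{\<alpha>. \<alpha> \<subseteq> N \<and> card \<alpha> = i + j}. finite {\<gamma>. \<gamma> \<subseteq> \<alpha> \<and> card \<gamma> = j}"
      using finite_subset[OF _ N] by auto
    show ?thesis
      unfolding sum.Sigma[OF fin fin']
    proof (rule sum.reindex_bij_witness[where i = "\<lambda>(\<alpha>, \<gamma>). (\<gamma>, \<alpha> - \<gamma>)"
          and j = "\<lambda>(\<gamma>, \<delta>). (\<gamma> \<union> \<delta>, \<gamma>)"])
      fix x assume "x \<in> (SIGMA \<alpha>:{\<alpha>. \<alpha> \<subseteq> N \<and> card \<alpha> = i + j}. {\<gamma>. \<gamma> \<subseteq> \<alpha> \<and> card \<gamma> = j})"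
      then obtain \<alpha> \<gamma> where x: "x = (\<alpha>, \<gamma>)" "\<alpha> \<subseteq> N" "card \<alpha> = i + j" "\<gamma> \<subseteq> \<alpha>" "card \<gamma> = j"
        by auto
      then have "card (\<alpha> - \<gamma>) = i"
        using finite_subset[OF _ N] by (metis add_diff_cancel_right' card_Diff_subset finite_subset)
      then show "(case x of (\<alpha>, \<gamma>) \<Rightarrow> (\<gamma>, \<alpha> - \<gamma>)) \<in>
          {x. case x of (\<gamma>, \<delta>) \<Rightarrow> (\<gamma>, \<delta>) \<in> S \<and> ?g (\<gamma>, \<delta>) = (i, j)}"
        using x by (auto simp: S_def)
    next
      fix x assume x: "x \<in> {x. case x of (\<gamma>, \<delta>) \<Rightarrow> (\<gamma>, \<delta>) \<in> S \<and> ?g (\<gamma>, \<delta>) = (i, j)}"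
      then obtain \<gamma> \<delta> where x: "x = (\<gamma>, \<delta>)" "(\<gamma>, \<delta>) \<in> S" "card \<delta> = i" "card \<gamma> = j"
        by auto
      then show "(case x of (\<gamma>, \<delta>) \<Rightarrow> (\<gamma> \<union> \<delta>, \<gamma>)) \<in>
          (SIGMA \<alpha>:{\<alpha>. \<alpha> \<subseteq> N \<and> card \<alpha> = i + j}. {\<gamma>. \<gamma> \<subseteq> \<alpha> \<and> card \<gamma> = j})"
        using S[OF x(2)] by (auto simp: card_Un_disjoint)
      have "\<gamma> \<union> \<delta> - \<gamma> = \<delta>"
        using S[OF x(2)] by auto
      then show "(case case x of (\<gamma>, \<delta>) \<Rightarrow> (\<gamma> \<union> \<delta>, \<gamma>) of (\<alpha>, \<gamma>) \<Rightarrow> (\<gamma>, \<alpha> - \<gamma>)) = x"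
        and "(case case x of (\<gamma>, \<delta>) \<Rightarrow> (\<gamma> \<union> \<delta>, \<gamma>) of (\<alpha>, \<gamma>) \<Rightarrow> F \<gamma> (\<alpha> - \<gamma>)) =
          (case x of (\<gamma>, \<delta>) \<Rightarrow> F \<gamma> \<delta>)"
        using x by simp_all
    qed auto
  qed
  have "(\<Sum>\<gamma>\<in>Pow N. \<Sum>\<delta>\<in>Pow (N - \<gamma>). F \<gamma> \<delta>) = (\<Sum>(\<gamma>, \<delta>)\<in>S. F \<gamma> \<delta>)"
    unfolding S_def using N by (intro sum.Sigma) auto
  also have "\<dots> = (\<Sum>y\<in>T. \<Sum>(\<gamma>, \<delta>) | (\<gamma>, \<delta>) \<in> S \<and> ?g (\<gamma>, \<delta>) = y. F \<gamma> \<delta>)"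
    using sum.group[OF fin img, of "\<lambda>(\<gamma>, \<delta>). F \<gamma> \<delta>"] by (simp add: case_prod_unfold)
  also have "\<dots> = (\<Sum>(i, j)\<in>T.
      \<Sum>\<alpha> | \<alpha> \<subseteq> N \<and> card \<alpha> = i + j. \<Sum>\<gamma> | \<gamma> \<subseteq> \<alpha> \<and> card \<gamma> = j. F \<gamma> (\<alpha> - \<gamma>))"
    using fibre by (intro sum.cong) auto
  also have "\<dots> = (\<Sum>i = 0..card N. \<Sum>j = 0..card N - i.
      \<Sum>\<alpha> | \<alpha> \<subseteq> N \<and> card \<alpha> = i + j. \<Sum>\<gamma> | \<gamma> \<subseteq> \<alpha> \<and> card \<gamma> = j. F \<gamma> (\<alpha> - \<gamma>))"
    unfolding T_def by (rule sum.Sigma[symmetric]) auto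
  finally show ?thesis .
qed

section \<open>The pairing for a diagonal matrix\<close>

text \<open>Sets of equal size that differ leave some \<open>r \<in> I\<close> outside \<open>J\<close>, and the row of \<open>r\<close> is then
  zero.\<close>

lemma det_submatrix_mat_diag_eq_0:
  fixes a :: "nat \<Rightarrow> 'a :: comm_ring_1"
  assumes I: "I \<subseteq> {0..<n}" and J: "J \<subseteq> {0..<n}" and card: "card I = card J" and "I \<noteq> J"
  shows "det (submatrix (mat_diag n a) I J) = 0"
proof -
  have fin: "finite I" "finite J"
    using I J finite_subset by auto
  have "\<not> I \<subseteq> J"
    using card_subset_eq[OF fin(2), of I] card \<open>I \<noteq> J\<close> by auto
  then obtain r where r: "r \<in> I" "r \<notin> J" by blast
  then obtain q where q: "q < card I" "pick I q = r"
    using bij_betw_imp_surj_on[OF bij_betw_pick[OF fin(1)]] by force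
  have X: "submatrix (mat_diag n a) I J =
      mat (card I) (card I) (\<lambda>(i, j). mat_diag n a $$ (pick I i, pick J j))"
    by (simp add: submatrix_eq_mat[OF _ I J, of "mat_diag n a"] card)
  have zero: "mat_diag n a $$ (pick I q, pick J j) = 0" if "j < card I" for j
  proof -
    have "pick J j \<in> J"
      using that card by (simp add: pick_in_set)
    then have "pick J j < n" "pick J j \<noteq> r" "r < n"
      using r J I by auto
    then show ?thesis using q by (simp add: mat_diag_def)
  qed
  have "(\<Prod>i\<in>{0..<card I}. submatrix (mat_diag n a) I J $$ (i, p i)) = 0"
    if "p permutes {0..<card I}" for p
    using q(1) permutes_in_image[OF that, of q] zero[of "p q"]
    by (intro prod_zero bexI[of _ q]) (auto simp: X)
  then show ?thesis
    by (subst det_def'[of _ "card I"]) (auto simp: X)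
qed

lemma principal_minor_mat_diag:
  fixes a :: "nat \<Rightarrow> 'a :: comm_ring_1"
  assumes "I \<subseteq> {0..<n}"
  shows "principal_minor (mat_diag n a) I = (\<Prod>r\<in>I. a r)"
proof -
  have fin: "finite I"
    using assms finite_subset by auto
  have "principal_minor (mat_diag n a) I =
      (\<Sum>p\<in>{id}. signof p * (\<Prod>i\<in>I. mat_diag n a $$ (i, p i)))"
    unfolding principal_minor_def
  proof (rule sum.mono_neutral_right)
    show "finite {p. p permutes I}"
      using fin by (rule finite_permutations)
    show "{id} \<subseteq> {p. p permutes I}"
      by (simp add: permutes_id)
    show "\<forall>p\<in>{p. p permutes I} - {id}. signof p * (\<Prod>i\<in>I. mat_diag n a $$ (i, p i)) = 0"
    proof
      fix p assume "p \<in> {p. p permutes I} - {id}"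
      then have p: "p permutes I" "p \<noteq> id" by auto
      then obtain i where i: "i \<in> I" "p i \<noteq> i"
        by (metis eq_id_iff permutes_not_in)
      then have "p i \<in> I"
        using permutes_in_image[OF p(1)] by simp
      then have "mat_diag n a $$ (i, p i) = 0"
        using i assms by (auto simp: mat_diag_def subset_iff)
      then have "(\<Prod>i\<in>I. mat_diag n a $$ (i, p i)) = 0"
        using i(1) fin by (intro prod_zero) auto
      then show "signof p * (\<Prod>i\<in>I. mat_diag n a $$ (i, p i)) = 0"
        by simp
    qed
  qed
  also have "\<dots> = (\<Prod>r\<in>I. a r)"
    using assms by (auto intro!: prod.cong simp: mat_diag_def)
  finally show ?thesis .
qed

lemma nth_k_subsets:
  assumes "r < n choose k"
  shows "k_subsets n k ! r \<subseteq> {0..<n}" "card (k_subsets n k ! r) = k"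
  using nth_mem[of r "k_subsets n k"] assms by (simp_all add: length_k_subsets set_k_subsets)

text \<open>The off-diagonal minors vanish and on the diagonal the sign exponent is even. The scalar case
  \<open>k = n\<close> fits the same formula, because the only \<open>n\<close>-element subset has an empty complement.\<close>

lemma adj_k_mat_diag:
  fixes a :: "nat \<Rightarrow> 'a :: comm_ring_1"
  assumes "0 < k" "k \<le> n"
  shows "adj_k k (mat_diag n a) =
    mat_diag (n choose k) (\<lambda>r. \<Prod>i\<in>{0..<n} - k_subsets n k ! r. a i)"
proof (cases "k = n")
  case True
  have "k_subsets n n ! 0 = {0..<n}"
    using nth_k_subsets[of 0 n n] by (simp add: card_subset_eq)
  with True assms show ?thesis
    by (intro eq_matI) (auto simp: adj_k_def mat_diag_def)
next
  case False
  let ?c = "\<lambda>r. {0..<n} - k_subsets n k ! r"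
  have entry: "(- 1) ^ (\<Sum>(k_subsets n k ! r) + \<Sum>(k_subsets n k ! s)) *
      det (submatrix (mat_diag n a) (?c s) (?c r)) =
      (if r = s then \<Prod>i\<in>?c s. a i else 0)"
    if "r < n choose k" "s < n choose k" for r s
  proof (cases "r = s")
    case True
    then show ?thesis
      by (simp add: det_submatrix_diagonal_block[of _ n] principal_minor_mat_diag)
  next
    case False
    then have "k_subsets n k ! r \<noteq> k_subsets n k ! s"
      using that distinct_k_subsets[of n k] by (simp add: nth_eq_iff_index_eq length_k_subsets)
    moreover have "finite (k_subsets n k ! r)" "finite (k_subsets n k ! s)"
      using nth_k_subsets(1)[OF that(1)] nth_k_subsets(1)[OF that(2)]
      by (auto intro: finite_subset)
    ultimately have "?c s \<noteq> ?c r" "card (?c s) = card (?c r)"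
      using nth_k_subsets[OF that(1)] nth_k_subsets[OF that(2)]
      by (auto simp: card_Diff_subset)
    then show ?thesis
      using False by (simp add: det_submatrix_mat_diag_eq_0)
  qed
  have dim: "dim_row (mat_diag n a) = n"
    by (simp add: mat_diag_def)
  show ?thesis
  proof (rule eq_matI)
    fix r s
    assume "r < dim_row (mat_diag (n choose k) (\<lambda>r. \<Prod>i\<in>?c r. a i))"
      and "s < dim_col (mat_diag (n choose k) (\<lambda>r. \<Prod>i\<in>?c r. a i))"
    then have rs: "r < n choose k" "s < n choose k"
      by (simp_all add: mat_diag_def)
    then have "adj_k k (mat_diag n a) $$ (r, s) =
        (- 1) ^ (\<Sum>(k_subsets n k ! r) + \<Sum>(k_subsets n k ! s)) *
        det (submatrix (mat_diag n a) (?c s) (?c r))"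
      using assms False by (simp add: adj_k_def dim Let_def)
    also have "\<dots> = (if r = s then \<Prod>i\<in>?c s. a i else 0)"
      by (rule entry[OF rs])
    also have "\<dots> = mat_diag (n choose k) (\<lambda>r. \<Prod>i\<in>?c r. a i) $$ (r, s)"
      using rs by (simp add: mat_diag_def)
    finally show "adj_k k (mat_diag n a) $$ (r, s) =
        mat_diag (n choose k) (\<lambda>r. \<Prod>i\<in>?c r. a i) $$ (r, s)" .
  qed (use assms False in \<open>simp_all add: adj_k_def dim Let_def, simp_all add: mat_diag_def\<close>)
qed

text \<open>On the diagonal the convention for \<open>j = 0\<close> agrees with the general formula, since the empty
  minor is \<open>1\<close>.\<close>

lemma C_kd_diagonal:
  assumes B: "B \<in> carrier_mat n n" and r: "r < n choose k"
  shows "C_kd k (int j) B $$ (r, r) =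
    (\<Sum>\<gamma> | \<gamma> \<subseteq> k_subsets n k ! r \<and> card \<gamma> = j. principal_minor B \<gamma>)"
proof (cases "j = 0")
  case True
  have "finite (k_subsets n k ! r)"
    using nth_k_subsets(1)[OF r] finite_subset by blast
  then have "{\<gamma>. \<gamma> \<subseteq> k_subsets n k ! r \<and> card \<gamma> = 0} = {{}}"
    using finite_subset by (auto simp: card_eq_0_iff)
  then show ?thesis
    using True B r by (simp add: C_kd_def)
next
  case False
  then show ?thesis
    using B r nth_k_subsets(1)[OF r]
    by (simp add: C_kd_def sum_principal_minors_submatrix)
qed

lemma mat_pairing_adj_k_C_kd:
  fixes a :: "nat \<Rightarrow> 'a :: comm_ring_1"
  assumes B: "B \<in> carrier_mat n n" and k: "0 < k" "k \<le> n"
  shows "mat_pairing (adj_k k (mat_diag n a)) (C_kd k (int j) B) =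
    (\<Sum>\<alpha> | \<alpha> \<subseteq> {0..<n} \<and> card \<alpha> = k.
      \<Sum>\<gamma> | \<gamma> \<subseteq> \<alpha> \<and> card \<gamma> = j. (\<Prod>r\<in>{0..<n} - \<alpha>. a r) * principal_minor B \<gamma>)"
proof -
  let ?K = "n choose k"
  let ?h = "\<lambda>\<alpha>. \<Sum>\<gamma> | \<gamma> \<subseteq> \<alpha> \<and> card \<gamma> = j. (\<Prod>r\<in>{0..<n} - \<alpha>. a r) * principal_minor B \<gamma>"
  have C: "C_kd k (int j) B \<in> carrier_mat ?K ?K"
    using B by (simp add: C_kd_def Let_def)
  have "mat_pairing (adj_k k (mat_diag n a)) (C_kd k (int j) B) =
      (\<Sum>r<?K. (\<Prod>i\<in>{0..<n} - k_subsets n k ! r. a i) * C_kd k (int j) B $$ (r, r))"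
    by (simp add: mat_pairing_def mat_trace_def adj_k_mat_diag[OF k] mat_diag_mult_left[OF C])
  also have "\<dots> = (\<Sum>r<?K. ?h (k_subsets n k ! r))"
    by (simp add: C_kd_diagonal[OF B] sum_distrib_left)
  also have "\<dots> = (\<Sum>\<alpha> | \<alpha> \<subseteq> {0..<n} \<and> card \<alpha> = k. ?h \<alpha>)"
    by (rule sum.reindex_bij_betw)
      (rule bij_betw_nth[OF distinct_k_subsets], simp_all add: length_k_subsets set_k_subsets)
  finally show ?thesis .
qed

lemma mat_pairing_C_kd_neg:
  assumes "B \<in> carrier_mat n n" "0 < k" "k \<le> n" "d < 0"
  shows "mat_pairing (adj_k k (mat_diag n a)) (C_kd k d B) = 0"
proof -
  have "C_kd k d B = 0\<^sub>m (n choose k) (n choose k)"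
    using assms by (simp add: C_kd_def)
  then show ?thesis
    using assms(2,3)
    by (simp add: mat_pairing_def mat_trace_def adj_k_mat_diag
        mat_diag_mult_left[of _ "n choose k" "n choose k"])
qed

section \<open>The coefficients of the characteristic polynomial\<close>

theorem proposition3p2:
  fixes m n :: nat and a :: "nat \<Rightarrow> real" and A B :: "real mat" and t :: real
  assumes "0 < m" and "m < n"
    and "\<And>k. k \<in> {1..n - m} \<Longrightarrow> 0 < a k"
    and "A = mat_diag n (\<lambda>r. if r < n - m then a (Suc r) else 0)"
    and "B \<in> carrier_mat n n" and "transpose_mat B = B"
  shows "char_poly (A + t \<cdot>\<^sub>m B) =
    (\<Sum>i = 0..n. \<Sum>j = int m - int i..int n - int i.
      monom ((- 1) ^ (n - i)
        * mat_pairing (adj_k (nat (int i + j)) A) (C_kd (nat (int i + j)) j B)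
        * t powi j) i)"
proof -
  let ?N = "{0..<n}"
  define d where "d = (\<lambda>r. if r < n - m then a (Suc r) else 0)"
  have A: "A = mat_diag n d"
    using assms(4) by (simp add: d_def)
  note B = \<open>B \<in> carrier_mat n n\<close>
  define c where "c = (\<lambda>i j. \<Sum>\<alpha> | \<alpha> \<subseteq> ?N \<and> card \<alpha> = i + j.
    \<Sum>\<gamma> | \<gamma> \<subseteq> \<alpha> \<and> card \<gamma> = j. (\<Prod>r\<in>?N - \<alpha>. d r) * principal_minor B \<gamma>)"
  define h where "h = (\<lambda>i j. monom ((- 1) ^ (n - i) * c i j * t ^ j) i)"
  define g where "g = (\<lambda>i j. monom ((- 1) ^ (n - i)
    * mat_pairing (adj_k (nat (int i + j)) A) (C_kd (nat (int i + j)) j B) * t powi j) i)"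
  (* The coefficients h run over all j from 0 to n - i, the terms g over the integers from m - i on.
     They agree on the common range; the remaining h have i + j < m, the remaining g have j < 0,
     and both kinds are zero. *)
  have vanish: "c i j = 0" if "i + j < m" for i j
  proof -
    have "(\<Prod>r\<in>?N - \<alpha>. d r) = 0" if \<alpha>: "\<alpha> \<subseteq> ?N" "card \<alpha> = i + j" for \<alpha>
    proof (rule prod_zero)
      have "finite \<alpha>"
        using \<alpha>(1) finite_subset by auto
      then have "\<not> {n - m..<n} \<subseteq> \<alpha>"
        using card_mono[of \<alpha> "{n - m..<n}"] \<alpha>(2) \<open>i + j < m\<close> \<open>m < n\<close> by auto
      then show "\<exists>r\<in>?N - \<alpha>. d r = 0"
        by (force simp: d_def)
    qed simp
    then show ?thesis
      unfolding c_def by (intro sum.neutral ballI) auto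
  qed
  have g_neg: "g i j = 0" if "j < 0" "int m \<le> int i + j" "int i + j \<le> int n" for i j
    using that \<open>0 < m\<close> B by (simp add: g_def A mat_pairing_C_kd_neg[of B n])
  have g_nonneg: "g i (int j) = h i j" if "m \<le> i + j" "i + j \<le> n" for i j
  proof -
    have "0 < i + j"
      using that \<open>0 < m\<close> by linarith
    from mat_pairing_adj_k_C_kd[OF B this that(2), of d j] show ?thesis
      by (simp add: g_def h_def A c_def nat_int_add)
  qed
  have inner: "(\<Sum>j = 0..n - i. h i j) = (\<Sum>j = int m - int i..int n - int i. g i j)"
    if "i \<le> n" for i
  proof -
    have "(\<Sum>j = int m - int i..int n - int i. g i j) = (\<Sum>j\<in>int ` {m - i..n - i}. g i j)"
    proof (rule sum.mono_neutral_right)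
      show "int ` {m - i..n - i} \<subseteq> {int m - int i..int n - int i}"
        using that by auto
      show "\<forall>j\<in>{int m - int i..int n - int i} - int ` {m - i..n - i}. g i j = 0"
      proof
        fix j assume j: "j \<in> {int m - int i..int n - int i} - int ` {m - i..n - i}"
        have "j < 0"
        proof (rule ccontr)
          assume "\<not> j < 0"
          then have "j = int (nat j)" "nat j \<in> {m - i..n - i}"
            using j by auto
          then show False using j by blast
        qed
        then show "g i j = 0"
          using j by (intro g_neg) auto
      qed
    qed simp
    also have "\<dots> = (\<Sum>j = m - i..n - i. g i (int j))"
      by (simp add: sum.reindex)
    also have "\<dots> = (\<Sum>j = m - i..n - i. h i j)"
      using that by (intro sum.cong g_nonneg) auto
    also have "\<dots> = (\<Sum>j = 0..n - i. h i j)"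
      by (rule sum.mono_neutral_left) (auto simp: h_def vanish)
    finally show ?thesis by simp
  qed
  have "char_poly (A + t \<cdot>\<^sub>m B) = (\<Sum>\<gamma>\<in>Pow ?N. \<Sum>\<delta>\<in>Pow (?N - \<gamma>).
      monom ((- 1) ^ (n - card \<delta>) *
        (t ^ card \<gamma> * ((\<Prod>r\<in>?N - \<gamma> - \<delta>. d r) * principal_minor B \<gamma>))) (card \<delta>))"
    unfolding A by (rule char_poly_diag_add_smult[OF B])
  also have "\<dots> = (\<Sum>i = 0..n. \<Sum>j = 0..n - i. \<Sum>\<alpha> | \<alpha> \<subseteq> ?N \<and> card \<alpha> = i + j.
      \<Sum>\<gamma> | \<gamma> \<subseteq> \<alpha> \<and> card \<gamma> = j. monom ((- 1) ^ (n - card (\<alpha> - \<gamma>)) *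
        (t ^ card \<gamma> * ((\<Prod>r\<in>?N - \<gamma> - (\<alpha> - \<gamma>). d r) * principal_minor B \<gamma>))) (card (\<alpha> - \<gamma>)))"
    by (subst sum_disjoint_pairs_by_card) simp_all
  also have "\<dots> = (\<Sum>i = 0..n. \<Sum>j = 0..n - i. h i j)"
  proof (intro sum.cong refl)
    fix i j
    have "(\<Sum>\<alpha> | \<alpha> \<subseteq> ?N \<and> card \<alpha> = i + j. \<Sum>\<gamma> | \<gamma> \<subseteq> \<alpha> \<and> card \<gamma> = j.
          monom ((- 1) ^ (n - card (\<alpha> - \<gamma>)) * (t ^ card \<gamma> *
            ((\<Prod>r\<in>?N - \<gamma> - (\<alpha> - \<gamma>). d r) * principal_minor B \<gamma>))) (card (\<alpha> - \<gamma>))) =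
        (\<Sum>\<alpha> | \<alpha> \<subseteq> ?N \<and> card \<alpha> = i + j. \<Sum>\<gamma> | \<gamma> \<subseteq> \<alpha> \<and> card \<gamma> = j.
          monom ((- 1) ^ (n - i) * t ^ j * ((\<Prod>r\<in>?N - \<alpha>. d r) * principal_minor B \<gamma>)) i)"
    proof (intro sum.cong refl)
      fix \<alpha> \<gamma>
      assume \<alpha>: "\<alpha> \<in> {\<alpha>. \<alpha> \<subseteq> ?N \<and> card \<alpha> = i + j}" and \<gamma>: "\<gamma> \<in> {\<gamma>. \<gamma> \<subseteq> \<alpha> \<and> card \<gamma> = j}"
      have "finite \<gamma>"
        using \<alpha> \<gamma> finite_subset[of \<gamma> ?N] by auto
      then have "card (\<alpha> - \<gamma>) = i"
        using \<alpha> \<gamma> by (simp add: card_Diff_subset)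
      moreover have "?N - \<gamma> - (\<alpha> - \<gamma>) = ?N - \<alpha>"
        using \<gamma> by auto
      ultimately show "monom ((- 1) ^ (n - card (\<alpha> - \<gamma>)) * (t ^ card \<gamma> *
            ((\<Prod>r\<in>?N - \<gamma> - (\<alpha> - \<gamma>). d r) * principal_minor B \<gamma>))) (card (\<alpha> - \<gamma>)) =
          monom ((- 1) ^ (n - i) * t ^ j * ((\<Prod>r\<in>?N - \<alpha>. d r) * principal_minor B \<gamma>)) i"
        using \<gamma> by (simp add: mult.assoc)
    qed
    also have "\<dots> = h i j"
      by (simp add: h_def c_def monom_sum sum_distrib_left mult_ac)
    finally show "(\<Sum>\<alpha> | \<alpha> \<subseteq> ?N \<and> card \<alpha> = i + j. \<Sum>\<gamma> | \<gamma> \<subseteq> \<alpha> \<and> card \<gamma> = j.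
        monom ((- 1) ^ (n - card (\<alpha> - \<gamma>)) * (t ^ card \<gamma> *
          ((\<Prod>r\<in>?N - \<gamma> - (\<alpha> - \<gamma>). d r) * principal_minor B \<gamma>))) (card (\<alpha> - \<gamma>))) = h i j" .
  qed
  also have "\<dots> = (\<Sum>i = 0..n. \<Sum>j = int m - int i..int n - int i. g i j)"
    by (intro sum.cong refl inner) simp
  finally show ?thesis
    unfolding g_def .
qed

end
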